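(* Let $G$ be a finite graph and $d\colon V(G)\to\mathbb N$. Then $\mathrm{tw}(G,d)=\mathrm{ew}(G,d)$.
   Context: Graphs are finite and undirected. A tree decomposition of $G$ is a pair $(T,B)$ with $T$ a rooted tree and $B=(B_t)_{t\in T}$ subsets of $V(G)$ (pieces) such that every vertex lies in some piece, every edge is contained in some piece, and for each vertex $v$ the set $\{t: v\in B_t\}$ is connected in $T$; its width is $\max_t|B_t|-1$. For a rooted tree $T$, $<_T$ is the tree order with the root as smallest element. For a vertex $v$, $t_v$ denotes the $<_T$-minimal node $t$ with $v\in B_t$. The decomposition is $d$-stratified if all $u,v\in V(G)$ with $t_u<_T t_v$ satisfy $d(u)\le d(v)$. $\mathrm{tw}(G,d)$ is the minimum width of a $d$-stratified tree decomposition of $G$. An elimination ordering of $(G,d)$ is a linear ordering $(v_1,\dots,v_n)$ of $V(G)$ such that $i<j$ implies $d(v_i)\le d(v_j)$. With it associate graphs $G_n:=G$, and for $1<i\le n$, $G_{i-1}$ has vertex set $V(G_i)\setminus\{v_i\}$ and edge set $\{e\in E(G_i): v_i\notin e\}\cup\{\{u,w\}: u\ne w,\ \{u,v_i\},\{v_i,w\}\in E(G_i)\}$. The width of the ordering is $\max_{i}\deg_{G_i}(v_i)$, and $\mathrm{ew}(G,d)$ is the minimum width of an elimination ordering of $(G,d)$. *)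

theory Defs
  imports Main
begin

text \<open>
  A graph is a pair of a vertex set and a set of edges, an edge being a two-element set of vertices;
  graphs are thus undirected and simple.
\<close>

type_synonym 'a ugraph = "'a set \<times> 'a set set"

abbreviation verts :: "'a ugraph \<Rightarrow> 'a set" where "verts \<equiv> fst"
abbreviation edges :: "'a ugraph \<Rightarrow> 'a set set" where "edges \<equiv> snd"

definition finite_graph :: "'a ugraph \<Rightarrow> bool" where
  "finite_graph G \<longleftrightarrow> finite (verts G) \<and> (\<forall>e\<in>edges G. e \<subseteq> verts G \<and> card e = 2)"

definition degree :: "'a ugraph \<Rightarrow> 'a \<Rightarrow> nat" where
  "degree G v = card {e \<in> edges G. v \<in> e}"

definition is_path :: "'a ugraph \<Rightarrow> 'a list \<Rightarrow> bool" where
  "is_path G p \<longleftrightarrow> p \<noteq> [] \<and> distinct p \<and> set p \<subseteq> verts G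
     \<and> successively (\<lambda>x y. {x, y} \<in> edges G) p"

definition is_cycle :: "'a ugraph \<Rightarrow> 'a list \<Rightarrow> bool" where
  "is_cycle G p \<longleftrightarrow> is_path G p \<and> 3 \<le> length p \<and> {last p, hd p} \<in> edges G"

definition connected_in :: "'a ugraph \<Rightarrow> 'a set \<Rightarrow> bool" where
  "connected_in G S \<longleftrightarrow>
     (\<forall>x\<in>S. \<forall>y\<in>S. \<exists>p. is_path G p \<and> hd p = x \<and> last p = y \<and> set p \<subseteq> S)"

definition is_tree :: "'a ugraph \<Rightarrow> bool" where
  "is_tree T \<longleftrightarrow> finite_graph T \<and> verts T \<noteq> {} \<and> connected_in T (verts T) \<and> (\<nexists>p. is_cycle T p)"

definition rooted_tree :: "'a ugraph \<Rightarrow> 'a \<Rightarrow> bool" where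
  "rooted_tree T r \<longleftrightarrow> is_tree T \<and> r \<in> verts T"

text \<open>The strict tree order: \<open>s\<close> lies on the path from the root \<open>r\<close> to \<open>t\<close> and \<open>s \<noteq> t\<close>.\<close>

definition tree_less :: "'a ugraph \<Rightarrow> 'a \<Rightarrow> 'a \<Rightarrow> 'a \<Rightarrow> bool" where
  "tree_less T r s t \<longleftrightarrow> s \<noteq> t \<and> (\<exists>p. is_path T p \<and> hd p = r \<and> last p = t \<and> s \<in> set p)"

definition tree_decomposition ::
    "'a ugraph \<Rightarrow> 't ugraph \<Rightarrow> 't \<Rightarrow> ('t \<Rightarrow> 'a set) \<Rightarrow> bool" where
  "tree_decomposition G T r B \<longleftrightarrow> rooted_tree T r
     \<and> (\<forall>t\<in>verts T. B t \<subseteq> verts G)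
     \<and> (\<forall>v\<in>verts G. \<exists>t\<in>verts T. v \<in> B t)
     \<and> (\<forall>e\<in>edges G. \<exists>t\<in>verts T. e \<subseteq> B t)
     \<and> (\<forall>v\<in>verts G. connected_in T {t \<in> verts T. v \<in> B t})"

definition td_width :: "'t ugraph \<Rightarrow> ('t \<Rightarrow> 'a set) \<Rightarrow> int" where
  "td_width T B = int (Max ((\<lambda>t. card (B t)) ` verts T)) - 1"

definition top_node :: "'t ugraph \<Rightarrow> 't \<Rightarrow> ('t \<Rightarrow> 'a set) \<Rightarrow> 'a \<Rightarrow> 't" where
  "top_node T r B v = (THE t. t \<in> verts T \<and> v \<in> B t
     \<and> \<not> (\<exists>s\<in>verts T. v \<in> B s \<and> tree_less T r s t))"

definition stratified ::
    "'a ugraph \<Rightarrow> ('a \<Rightarrow> nat) \<Rightarrow> 't ugraph \<Rightarrow> 't \<Rightarrow> ('t \<Rightarrow> 'a set) \<Rightarrow> bool" where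
  "stratified G d T r B \<longleftrightarrow> (\<forall>u\<in>verts G. \<forall>v\<in>verts G.
     tree_less T r (top_node T r B u) (top_node T r B v) \<longrightarrow> d u \<le> d v)"

text \<open>
  Trees are finite, so taking the tree nodes to be natural numbers is no restriction up to
  isomorphism.
\<close>

definition tw :: "'a ugraph \<Rightarrow> ('a \<Rightarrow> nat) \<Rightarrow> int" where
  "tw G d = (LEAST w. \<exists>(T :: nat ugraph) r B.
     tree_decomposition G T r B \<and> stratified G d T r B \<and> td_width T B = w)"

text \<open>
  The ordering \<open>(v\<^sub>1, \<dots>, v\<^sub>n)\<close> is the list \<open>vs\<close>, so \<open>v\<^sub>i\<close> is \<open>vs ! (i - 1)\<close>.
\<close>

definition elimination_ordering :: "'a ugraph \<Rightarrow> ('a \<Rightarrow> nat) \<Rightarrow> 'a list \<Rightarrow> bool" where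
  "elimination_ordering G d vs \<longleftrightarrow> distinct vs \<and> set vs = verts G
     \<and> (\<forall>i j. i < j \<and> j < length vs \<longrightarrow> d (vs ! i) \<le> d (vs ! j))"

definition eliminate :: "'a \<Rightarrow> 'a ugraph \<Rightarrow> 'a ugraph" where
  "eliminate v G = (verts G - {v},
     {e \<in> edges G. v \<notin> e} \<union> {{u, w} |u w. u \<noteq> w \<and> {u, v} \<in> edges G \<and> {v, w} \<in> edges G})"

text \<open>
  The graph \<open>G\<^sub>i\<close>: the vertices \<open>v\<^sub>n, \<dots>, v\<^bsub>i+1\<^esub>\<close> are eliminated from \<open>G\<close> in this order
  (\<^const>\<open>foldr\<close> applies the last list element first).
\<close>

definition elim_graph :: "'a ugraph \<Rightarrow> 'a list \<Rightarrow> nat \<Rightarrow> 'a ugraph" where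
  "elim_graph G vs i = foldr eliminate (drop i vs) G"

text \<open>
  The empty ordering, which exists only for the graph without vertices, gets width \<open>-1\<close>; this is
  also the width of the tree decompositions of that graph.
\<close>

definition ordering_width :: "'a ugraph \<Rightarrow> 'a list \<Rightarrow> int" where
  "ordering_width G vs = (if vs = [] then -1
     else int (Max ((\<lambda>i. degree (elim_graph G vs i) (vs ! (i - 1))) ` {1..length vs})))"

definition ew :: "'a ugraph \<Rightarrow> ('a \<Rightarrow> nat) \<Rightarrow> int" where
  "ew G d = (LEAST w. \<exists>vs. elimination_ordering G d vs \<and> ordering_width G vs = w)"

end

theory Submission
  imports Defs "HOL-Library.Product_Lexorder"
begin

text \<open>
  Given a stratified tree decomposition, order the vertices by \<open>d\<close> and, for equal \<open>d\<close>, by the depth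
  of their top nodes. By stratification, \<open>t\<^sub>u <\<^sub>T t\<^sub>v\<close> then forces \<open>u\<close> before \<open>v\<close>. When \<open>v\<close> is eliminated,
  each neighbour \<open>u\<close> shares a piece with \<open>v\<close> and precedes it, so \<open>t\<^sub>u \<le> t\<^sub>v\<close> and by connectedness \<open>u\<close>
  lies in the piece at \<open>t\<^sub>v\<close>; hence the degree is bounded by the width, and the new edges are again
  covered by that piece. Conversely, an ordering yields a tree on the indices whose node \<open>i\<close> carries
  \<open>v\<^sub>i\<close> together with its neighbours in \<open>G\<^sub>i\<close>; node \<open>i\<close> is the top node of \<open>v\<^sub>i\<close> and the order of the
  indices extends the tree order, which gives stratification.
\<close>

section \<open>Paths in trees\<close>

lemma is_path_append_iff:
  "p \<noteq> [] \<Longrightarrow> q \<noteq> [] \<Longrightarrow> is_path G (p @ q) \<longleftrightarrow>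
    is_path G p \<and> is_path G q \<and> set p \<inter> set q = {} \<and> {last p, hd q} \<in> edges G"
  by (auto simp: is_path_def successively_append_iff)

lemma is_path_singleton [simp]: "is_path G [x] \<longleftrightarrow> x \<in> verts G"
  by (auto simp: is_path_def)

lemma is_path_rev: "is_path G (rev p) \<longleftrightarrow> is_path G p"
  by (auto simp: is_path_def insert_commute)

text \<open>Strip the common first vertex. If the next vertices differ, following \<open>p'\<close>
  to its first vertex on \<open>q'\<close> and returning along \<open>q'\<close> closes a cycle
  through \<open>x\<close>.\<close>

lemma path_unique:
  assumes acyclic: "\<nexists>p. is_cycle G p"
  shows "is_path G p \<Longrightarrow> is_path G q \<Longrightarrow> hd p = hd q \<Longrightarrow> last p = last q \<Longrightarrow> p = q"
proof (induction p arbitrary: q)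
  case Nil
  then show ?case by (simp add: is_path_def)
next
  case (Cons x p')
  obtain q' where q: "q = x # q'"
    using Cons.prems by (cases q) (auto simp: is_path_def)
  consider "p' = []" | "q' = []" | "p' \<noteq> []" "q' \<noteq> []" "hd p' = hd q'"
    | "p' \<noteq> []" "q' \<noteq> []" "hd p' \<noteq> hd q'"
    by blast
  then show ?case
  proof cases
    case 1
    then show ?thesis
      using Cons.prems q by (metis distinct.simps(2) is_path_def last.simps last_in_set)
  next
    case 2
    then show ?thesis
      using Cons.prems q by (metis distinct.simps(2) is_path_def last.simps last_in_set)
  next
    case 3
    have "is_path G p'" "is_path G q'"
      using is_path_append_iff[of "[x]" p' G] is_path_append_iff[of "[x]" q' G] Cons.prems q 3
      by auto
    with Cons.IH[of q'] Cons.prems(4) q 3 show ?thesis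
      by simp
  next
    case 4
    have p': "is_path G p'" "x \<notin> set p'" "{x, hd p'} \<in> edges G"
      using is_path_append_iff[of "[x]" p' G] Cons.prems 4 by auto
    have q': "is_path G q'" "x \<notin> set q'" "{x, hd q'} \<in> edges G"
      using is_path_append_iff[of "[x]" q' G] Cons.prems 4 q by auto
    \<comment> \<open>The common endpoint guarantees a meeting point. Choosing the first one along
      \<open>p'\<close> keeps \<open>p1\<close> disjoint from \<open>q'\<close>, so the closed walk
      \<open>?c\<close> repeats no vertex.\<close>
    have "\<exists>z\<in>set p'. z \<in> set q'"
      using Cons.prems(4) q 4 by (metis last.simps last_in_set)
    then obtain p1 z p2 where p1: "p' = p1 @ z # p2" "z \<in> set q'" "\<forall>y\<in>set p1. y \<notin> set q'"
      by (auto dest!: split_list_first_prop)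
    then obtain q1 q2 where q1: "q' = q1 @ z # q2"
      by (auto dest!: split_list)
    let ?c = "x # p1 @ z # rev q1"
    have "successively (\<lambda>x y. {x, y} \<in> edges G) ?c"
      using p' q' p1 q1
      by (auto simp: is_path_def successively_Cons successively_append_iff hd_append hd_rev
          insert_commute split: if_splits)
    moreover have "distinct ?c" "set ?c \<subseteq> verts G"
      using p' q' p1 q1 Cons.prems(1) by (auto simp: is_path_def)
    moreover have "3 \<le> length ?c"
    proof -
      \<comment> \<open>If both were empty, \<open>z\<close> would be the head of \<open>p'\<close>
        and of \<open>q'\<close>.\<close>
      have "p1 \<noteq> [] \<or> q1 \<noteq> []" using 4 p1 q1 by auto
      then show ?thesis by (cases p1; cases q1) auto
    qed
    moreover have "{last ?c, hd ?c} \<in> edges G"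
      using q'(3) q1 by (cases q1) (auto simp: insert_commute)
    ultimately have "is_cycle G ?c"
      by (auto simp: is_cycle_def is_path_def)
    then show ?thesis using acyclic by blast
  qed
qed

section \<open>The tree order expressed through paths from the root\<close>

text \<open>In a rooted tree, \<open>s \<in> set (root_path T r t)\<close> is the reflexive tree
  order on nodes, and the length of the list measures the depth of \<open>t\<close>.\<close>

definition root_path :: "'t ugraph \<Rightarrow> 't \<Rightarrow> 't \<Rightarrow> 't list" where
  "root_path T r t = (THE p. is_path T p \<and> hd p = r \<and> last p = t)"

context
  fixes T :: "'t ugraph" and r :: 't
  assumes tree: "rooted_tree T r"
begin

lemma tree_path_unique:
  "is_path T p \<Longrightarrow> is_path T q \<Longrightarrow> hd p = hd q \<Longrightarrow> last p = last q \<Longrightarrow> p = q"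
  using path_unique[of T p q] tree by (auto simp: rooted_tree_def is_tree_def)

lemma root_path_eq: "is_path T p \<Longrightarrow> hd p = r \<Longrightarrow> root_path T r (last p) = p"
  unfolding root_path_def by (rule the_equality) (auto intro: tree_path_unique)

lemma root_path:
  assumes "t \<in> verts T"
  shows "is_path T (root_path T r t)" "hd (root_path T r t) = r" "last (root_path T r t) = t"
proof -
  obtain p where "is_path T p" "hd p = r" "last p = t"
    using assms tree unfolding rooted_tree_def is_tree_def connected_in_def by blast
  with root_path_eq[of p]
  show "is_path T (root_path T r t)" "hd (root_path T r t) = r" "last (root_path T r t) = t"
    by auto
qed

lemma root_path_neq_Nil: "t \<in> verts T \<Longrightarrow> root_path T r t \<noteq> []"
  using root_path(1) by (auto simp: is_path_def)

lemma tree_less_iff: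
  "t \<in> verts T \<Longrightarrow> tree_less T r s t \<longleftrightarrow> s \<noteq> t \<and> s \<in> set (root_path T r t)"
  unfolding tree_less_def using root_path[of t] root_path_eq by auto

lemma in_root_path_verts: "t \<in> verts T \<Longrightarrow> s \<in> set (root_path T r t) \<Longrightarrow> s \<in> verts T"
  using root_path(1) by (auto simp: is_path_def)

text \<open>Cutting the path to \<open>t\<close> after \<open>s\<close> leaves a path from the root
  to \<open>s\<close>, which is unique.\<close>

lemma root_path_prefix:
  assumes "t \<in> verts T" "s \<in> set (root_path T r t)"
  obtains q where "root_path T r t = root_path T r s @ q"
proof -
  obtain a b where ab: "root_path T r t = a @ s # b"
    using assms(2) by (auto dest!: split_list)
  have "is_path T (a @ [s])"
    using root_path(1)[OF assms(1)] is_path_append_iff[of "a @ [s]" b T] unfolding ab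
    by (cases "b = []") auto
  moreover have "hd (a @ [s]) = r"
    using root_path(2)[OF assms(1)] unfolding ab by (cases a) auto
  ultimately have "root_path T r s = a @ [s]"
    using root_path_eq by fastforce
  then show ?thesis using ab that by auto
qed

lemma root_path_antisym:
  assumes "t \<in> verts T" "s \<in> set (root_path T r t)" "t \<in> set (root_path T r s)"
  shows "s = t"
proof -
  have s: "s \<in> verts T" using assms in_root_path_verts by blast
  obtain q q' where "root_path T r t = root_path T r s @ q" "root_path T r s = root_path T r t @ q'"
    using root_path_prefix[OF assms(1,2)] root_path_prefix[OF s assms(3)] by metis
  then have "root_path T r t = root_path T r s" by auto
  then show ?thesis using root_path(3) s assms(1) by metis
qed

text \<open>Both root paths are prefixes of one list, so one is a prefix of the other.\<close>

lemma root_path_chain: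
  assumes t: "t \<in> verts T" and a: "a \<in> set (root_path T r t)" and b: "b \<in> set (root_path T r t)"
  shows "a \<in> set (root_path T r b) \<or> b \<in> set (root_path T r a)"
proof -
  have ab: "a \<in> verts T" "b \<in> verts T" using in_root_path_verts assms by auto
  obtain q q' where "root_path T r t = root_path T r a @ q" "root_path T r t = root_path T r b @ q'"
    using root_path_prefix[OF t a] root_path_prefix[OF t b] by metis
  then obtain us where "root_path T r a = root_path T r b @ us \<or> root_path T r a @ us = root_path T r b"
    by (metis append_eq_append_conv2)
  moreover have "a \<in> set (root_path T r a)" "b \<in> set (root_path T r b)"
    using root_path(3) root_path_neq_Nil ab last_in_set by metis+
  ultimately show ?thesis by (metis Un_iff set_append)
qed

text \<open>One end of an edge is the parent of the other, so crossing an edge changes the root path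
  by a single vertex at its end.\<close>

lemma root_path_adjacent:
  assumes "{x, y} \<in> edges T"
  shows "root_path T r y = root_path T r x @ [y] \<or> root_path T r x = root_path T r y @ [x]"
proof -
  have "{x, y} \<subseteq> verts T" "card {x, y} = 2"
    using assms tree by (auto simp: rooted_tree_def is_tree_def finite_graph_def)
  then have xy: "x \<in> verts T" "y \<in> verts T" "x \<noteq> y" by auto
  show ?thesis
  proof (cases "y \<in> set (root_path T r x)")
    case False
    then have "is_path T (root_path T r x @ [y])"
      using root_path[OF xy(1)] root_path_neq_Nil[OF xy(1)] xy(2) assms
      by (subst is_path_append_iff) auto
    from root_path_eq[OF this] show ?thesis
      using root_path[OF xy(1)] root_path_neq_Nil[OF xy(1)] by simp
  next
    case True
    obtain q where q: "root_path T r x = root_path T r y @ q"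
      using root_path_prefix[OF xy(1) True] .
    have "q \<noteq> []" using q root_path(3)[OF xy(1)] root_path(3)[OF xy(2)] xy(3) by auto
    have "y \<in> set (root_path T r y)"
      using root_path(3)[OF xy(2)] root_path_neq_Nil[OF xy(2)] last_in_set by metis
    with \<open>q \<noteq> []\<close> have "is_path T q" "{y, hd q} \<in> edges T" "y \<notin> set q" "last q = x"
      using q root_path[OF xy(1)] root_path[OF xy(2)] root_path_neq_Nil[OF xy(2)]
        is_path_append_iff[of "root_path T r y" q T] by (auto simp: disjoint_iff)
    \<comment> \<open>The rest of the root path leads from \<open>y\<close> to \<open>x\<close>, and
      so does the edge itself; uniqueness forces \<open>q = [x]\<close>.\<close>
    then have "is_path T ([y] @ q)"
      using \<open>q \<noteq> []\<close> xy by (subst is_path_append_iff) auto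
    moreover have "is_path T ([y] @ [x])"
      using xy assms by (subst is_path_append_iff) (auto simp: insert_commute)
    ultimately have "[y] @ q = [y] @ [x]"
      using \<open>q \<noteq> []\<close> \<open>last q = x\<close> by (intro tree_path_unique) auto
    then show ?thesis using q by simp
  qed
qed

text \<open>Take \<open>m\<close> of least depth in \<open>S\<close>. Lying above a node is
  preserved along paths inside \<open>S\<close>: it could be lost only by stepping from
  \<open>m\<close> to its parent, which would be a shallower node of \<open>S\<close>.\<close>

lemma connected_has_least_node:
  assumes "S \<subseteq> verts T" "connected_in T S" "S \<noteq> {}"
  obtains m where "m \<in> S" "\<And>s. s \<in> S \<Longrightarrow> m \<in> set (root_path T r s)"
proof -
  obtain m where m: "m \<in> S" "\<And>s. s \<in> S \<Longrightarrow> length (root_path T r m) \<le> length (root_path T r s)"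
    using assms(3) ex_has_least_nat[of "\<lambda>s. s \<in> S" _ "\<lambda>s. length (root_path T r s)"] by blast
  have along: "is_path T p \<Longrightarrow> set p \<subseteq> S \<Longrightarrow> m \<in> set (root_path T r (hd p)) \<Longrightarrow>
      m \<in> set (root_path T r (last p))" for p
  proof (induction p rule: rev_induct)
    case Nil
    then show ?case by (simp add: is_path_def)
  next
    case (snoc y p)
    show ?case
    proof (cases "p = []")
      case True
      then show ?thesis using snoc.prems by simp
    next
      case False
      then have p: "is_path T p" "{last p, y} \<in> edges T"
        using snoc.prems is_path_append_iff[of p "[y]" T] by auto
      let ?x = "last p"
      have x: "m \<in> set (root_path T r ?x)" using snoc p False by simp
      have ne: "root_path T r ?x = root_path T r y @ [?x] \<Longrightarrow> m \<noteq> ?x"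
        using m(2)[of y] snoc.prems(2) by auto
      from root_path_adjacent[OF p(2)] x ne show ?thesis
        by (metis Un_iff empty_iff empty_set last_snoc set_ConsD set_append)
    qed
  qed
  have "m \<in> set (root_path T r s)" if "s \<in> S" for s
  proof -
    obtain p where p: "is_path T p" "hd p = m" "last p = s" "set p \<subseteq> S"
      using assms(2) m(1) \<open>s \<in> S\<close> unfolding connected_in_def by blast
    have "m \<in> verts T" using m(1) assms(1) by blast
    then have "m \<in> set (root_path T r m)"
      using root_path(3) root_path_neq_Nil last_in_set by metis
    then show ?thesis using along[OF p(1,4)] p by simp
  qed
  then show ?thesis using that m(1) by blast
qed

text \<open>The path inside \<open>S\<close> from \<open>a\<close> to \<open>s\<close> must be the
  final segment of the root path of \<open>s\<close> starting at \<open>a\<close>, and this segment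
  passes through \<open>b\<close>.\<close>

lemma connected_convex:
  assumes S: "S \<subseteq> verts T" "connected_in T S" and "a \<in> S" "s \<in> S"
    and ab: "a \<in> set (root_path T r b)" and bs: "b \<in> set (root_path T r s)"
  shows "b \<in> S"
proof -
  obtain p where p: "is_path T p" "hd p = a" "last p = s" "set p \<subseteq> S"
    using assms unfolding connected_in_def by blast
  have s: "s \<in> verts T" using assms by blast
  then have b: "b \<in> verts T" using bs in_root_path_verts by blast
  obtain q where q: "root_path T r s = root_path T r b @ q" using root_path_prefix[OF s bs] .
  obtain u w where uw: "root_path T r b = u @ a # w" using ab by (auto dest!: split_list)
  have "is_path T (a # w @ q)"
    using is_path_append_iff[of u "a # w @ q" T] root_path(1)[OF s] q uw by (cases "u = []") auto
  moreover have "last (a # w @ q) = s"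
    using root_path(3)[OF s] q uw by (auto split: if_splits)
  ultimately have "p = a # w @ q"
    using p by (intro tree_path_unique) auto
  moreover have "b \<in> set (a # w)"
    using root_path(3)[OF b] uw by (metis last_appendR last_in_set list.discI)
  ultimately show ?thesis using p(4) by auto
qed

text \<open>Connectedness supplies a least node, which is therefore the only minimal one; this
  justifies the definite description in \<open>top_node\<close>.\<close>

lemma top_node:
  assumes conn: "connected_in T {t \<in> verts T. v \<in> B t}" and t: "t \<in> verts T" "v \<in> B t"
  shows "top_node T r B v \<in> verts T" "v \<in> B (top_node T r B v)"
    "top_node T r B v \<in> set (root_path T r t)"
proof -
  obtain m where "m \<in> {t \<in> verts T. v \<in> B t}"
      and least: "\<And>s. s \<in> {t \<in> verts T. v \<in> B t} \<Longrightarrow> m \<in> set (root_path T r s)"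
    using connected_has_least_node[OF _ conn] t by blast
  then have m: "m \<in> verts T" "v \<in> B m" by auto
  have "top_node T r B v = m"
    unfolding top_node_def
  proof (rule the_equality)
    show "m \<in> verts T \<and> v \<in> B m \<and> \<not> (\<exists>s\<in>verts T. v \<in> B s \<and> tree_less T r s m)"
      using m least root_path_antisym by (auto simp: tree_less_iff)
  next
    fix x assume "x \<in> verts T \<and> v \<in> B x \<and> \<not> (\<exists>s\<in>verts T. v \<in> B s \<and> tree_less T r s x)"
    then show "x = m" using m least[of x] by (auto simp: tree_less_iff)
  qed
  then show "top_node T r B v \<in> verts T" "v \<in> B (top_node T r B v)"
      "top_node T r B v \<in> set (root_path T r t)"
    using m least t by auto
qed

lemma tree_less_length:
  assumes "t \<in> verts T" "tree_less T r s t"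
  shows "length (root_path T r s) < length (root_path T r t)"
proof -
  have s: "s \<in> set (root_path T r t)" "s \<noteq> t" using assms by (auto simp: tree_less_iff)
  obtain q where q: "root_path T r t = root_path T r s @ q"
    using root_path_prefix[OF assms(1) s(1)] .
  have "q \<noteq> []"
    using q root_path(3)[OF assms(1)] root_path(3)[OF in_root_path_verts[OF assms(1) s(1)]] s(2)
    by auto
  then show ?thesis using q by simp
qed

text \<open>A neighbour \<open>u\<close> of \<open>v\<close> that is eliminated after \<open>v\<close> lies in the piece at the top node of \<open>v\<close>.\<close>

lemma common_piece_top_node:
  assumes "connected_in T {t \<in> verts T. u \<in> B t}" "connected_in T {t \<in> verts T. v \<in> B t}"
    and s: "s \<in> verts T" "u \<in> B s" "v \<in> B s"
    and "\<not> tree_less T r (top_node T r B v) (top_node T r B u)"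
  shows "u \<in> B (top_node T r B v)"
proof -
  note u = top_node[OF assms(1) s(1,2)] and v = top_node[OF assms(2) s(1,3)]
  show ?thesis
  proof (cases "top_node T r B v = top_node T r B u")
    case False
    \<comment> \<open>Both top nodes lie on the root path of the shared node \<open>s\<close>, hence
      are comparable, and the last hypothesis excludes one direction.\<close>
    then have "top_node T r B u \<in> set (root_path T r (top_node T r B v))"
      using root_path_chain[OF s(1) u(3) v(3)] assms(6) u(1) by (simp add: tree_less_iff)
    with connected_convex[OF _ assms(1), of "top_node T r B u" s "top_node T r B v"] u v s
    show ?thesis by auto
  qed (use u in simp)
qed

end

section \<open>Elimination of vertices\<close>

definition neighbours :: "'a ugraph \<Rightarrow> 'a \<Rightarrow> 'a set" where
  "neighbours G v = {u. {u, v} \<in> edges G}"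

lemma neighbours_subset: "finite_graph G \<Longrightarrow> neighbours G v \<subseteq> verts G - {v}"
  by (force simp: neighbours_def finite_graph_def)

lemma degree_eq_card_neighbours:
  assumes "finite_graph G"
  shows "degree G v = card (neighbours G v)"
proof -
  have "{e \<in> edges G. v \<in> e} = (\<lambda>u. {u, v}) ` neighbours G v"
  proof
    show "{e \<in> edges G. v \<in> e} \<subseteq> (\<lambda>u. {u, v}) ` neighbours G v"
    proof
      fix e assume "e \<in> {e \<in> edges G. v \<in> e}"
      then have e: "e \<in> edges G" "v \<in> e" by auto
      then obtain a b where "e = {a, b}"
        using assms by (auto simp: finite_graph_def card_2_iff)
      then obtain u where "e = {u, v}" using e(2) by (auto simp: insert_commute)
      then show "e \<in> (\<lambda>u. {u, v}) ` neighbours G v" using e by (auto simp: neighbours_def)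
    qed
  qed (auto simp: neighbours_def)
  moreover have "inj_on (\<lambda>u. {u, v}) (neighbours G v)"
    by (auto simp: inj_on_def doubleton_eq_iff)
  ultimately show ?thesis by (simp add: degree_def card_image)
qed

lemma finite_graph_eliminate:
  assumes "finite_graph G"
  shows "finite_graph (eliminate v G)"
proof -
  have "e \<subseteq> verts G - {v} \<and> card e = 2"
    if "u \<noteq> w" "{u, v} \<in> edges G" "{v, w} \<in> edges G" "e = {u, w}" for e u w
    using that neighbours_subset[OF assms, of v]
    by (auto simp: neighbours_def insert_commute subset_iff)
  then show ?thesis
    using assms unfolding finite_graph_def eliminate_def by fastforce
qed

lemma verts_eliminate [simp]: "verts (eliminate v G) = verts G - {v}"
  by (simp add: eliminate_def)

lemma edges_eliminate_keep: "e \<in> edges G \<Longrightarrow> v \<notin> e \<Longrightarrow> e \<in> edges (eliminate v G)"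
  by (simp add: eliminate_def)

lemma edges_eliminate_clique:
  "u \<in> neighbours G v \<Longrightarrow> w \<in> neighbours G v \<Longrightarrow> u \<noteq> w \<Longrightarrow> {u, w} \<in> edges (eliminate v G)"
  unfolding eliminate_def neighbours_def insert_commute[of v _ "{}"] by auto

text \<open>For a new edge only its containment in the neighbourhood of \<open>v\<close> is
  recorded; a piece containing that neighbourhood then covers all new edges at once.\<close>

lemma edges_eliminateE:
  assumes "e \<in> edges (eliminate v G)"
  obtains "e \<in> edges G" "v \<notin> e" | "e \<subseteq> neighbours G v"
  using assms unfolding eliminate_def neighbours_def insert_commute[of v _ "{}"] by auto

text \<open>The right fold eliminates \<open>v\<close> first, so induction from the end of the list
  follows the order of elimination.\<close>

lemma elim_graph_snoc:
  "i \<le> length us \<Longrightarrow> elim_graph G (us @ [v]) i = elim_graph (eliminate v G) us i"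
  by (simp add: elim_graph_def)

lemma elim_graph_length [simp]: "elim_graph G vs (length vs) = G"
  by (simp add: elim_graph_def)

section \<open>From stratified tree decompositions to orderings\<close>

text \<open>The tree and its pieces stay fixed while the graph shrinks. Pieces may thus contain
  eliminated vertices, so they are only assumed to be finite with at most \<open>k\<close> elements,
  not to be subsets of \<open>verts G\<close>.\<close>

lemma degree_elim_graph_less_width:
  assumes tree: "rooted_tree T r"
  shows "finite_graph G \<Longrightarrow> distinct vs \<Longrightarrow> set vs = verts G \<Longrightarrow>
    (\<forall>v\<in>verts G. (\<exists>t\<in>verts T. v \<in> B t) \<and> connected_in T {t \<in> verts T. v \<in> B t}) \<Longrightarrow>
    (\<forall>e\<in>edges G. \<exists>t\<in>verts T. e \<subseteq> B t) \<Longrightarrow>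
    sorted_wrt (\<lambda>u v. \<not> tree_less T r (top_node T r B v) (top_node T r B u)) vs \<Longrightarrow>
    (\<forall>t\<in>verts T. finite (B t) \<and> card (B t) \<le> k) \<Longrightarrow>
    i \<in> {1..length vs} \<Longrightarrow> degree (elim_graph G vs i) (vs ! (i - 1)) < k"
proof (induction vs arbitrary: G i rule: rev_induct)
  case Nil
  then show ?case by simp
next
  case (snoc v us)
  let ?t = "top_node T r B v"
  have v: "v \<in> verts G" using snoc.prems by auto
  have t: "?t \<in> verts T" "v \<in> B ?t"
    using snoc.prems(4) v top_node(1,2)[OF tree, of v B] by auto
  have nb: "neighbours G v \<subseteq> B ?t"
  proof
    fix u assume u: "u \<in> neighbours G v"
    then have u': "u \<in> verts G" "u \<noteq> v" using neighbours_subset[OF snoc.prems(1)] by auto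
    then have "u \<in> set us" using snoc.prems(3) by auto
    then have "\<not> tree_less T r ?t (top_node T r B u)"
      using snoc.prems(6) by (auto simp: sorted_wrt_append)
    moreover obtain s where "s \<in> verts T" "u \<in> B s" "v \<in> B s"
      using u snoc.prems(5) by (auto simp: neighbours_def)
    ultimately show "u \<in> B ?t"
      using common_piece_top_node[OF tree, of u B v s] snoc.prems(4) u' v by simp
  qed
  show ?case
  proof (cases "i = Suc (length us)")
    case True
    have "degree G v = card (neighbours G v)"
      by (rule degree_eq_card_neighbours[OF snoc.prems(1)])
    \<comment> \<open>The inequality is strict because the piece also contains \<open>v\<close>,
      which is not its own neighbour.\<close>
    also have "\<dots> < card (B ?t)"
      using nb t snoc.prems(7) neighbours_subset[OF snoc.prems(1), of v]
      by (intro psubset_card_mono) auto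
    also have "\<dots> \<le> k" using snoc.prems(7) t by auto
    finally show ?thesis using True elim_graph_length[of G "us @ [v]"] by simp
  next
    case False
    then have i: "i \<in> {1..length us}" using snoc.prems(8) by auto
    have "degree (elim_graph (eliminate v G) us i) (us ! (i - 1)) < k"
    proof (rule snoc.IH[OF _ _ _ _ _ _ _ i])
      \<comment> \<open>Old edges keep their pieces; new edges lie in the neighbourhood of
        \<open>v\<close>, hence in the piece at \<open>?t\<close>.\<close>
      show "\<forall>e\<in>edges (eliminate v G). \<exists>t\<in>verts T. e \<subseteq> B t"
        using snoc.prems(5) nb t by (blast elim: edges_eliminateE)
    qed (use snoc.prems finite_graph_eliminate[OF snoc.prems(1)] in \<open>auto simp: sorted_wrt_append\<close>)
    then show ?thesis using i by (auto simp: elim_graph_snoc nth_append)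
  qed
qed

lemma ordering_of_tree_decomposition:
  assumes G: "finite_graph G" and td: "tree_decomposition G T r B" and st: "stratified G d T r B"
  obtains vs where "elimination_ordering G d vs" "ordering_width G vs \<le> td_width T B"
proof -
  have tree: "rooted_tree T r" using td by (simp add: tree_decomposition_def)
  have finV: "finite (verts G)" and finT: "finite (verts T)"
    using G tree by (auto simp: finite_graph_def rooted_tree_def is_tree_def)
  define depth where "depth v = length (root_path T r (top_node T r B v))" for v
  define key where "key v = (d v, depth v)" for v
  obtain xs where xs: "set xs = verts G" "distinct xs"
    using finite_distinct_list[OF finV] by blast
  define vs where "vs = sort_key key xs"
  have vs: "set vs = verts G" "distinct vs" using xs by (auto simp: vs_def)
  have "sorted (map key vs)" by (simp add: vs_def)
  then have sorted: "sorted_wrt (\<lambda>u v. key u \<le> key v) vs" by (simp add: sorted_map)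
  have ord: "elimination_ordering G d vs"
    unfolding elimination_ordering_def
    using vs sorted by (auto simp: sorted_wrt_iff_nth_less key_def less_eq_prod_def intro: less_imp_le)
  have pieces: "\<forall>v\<in>verts G. (\<exists>t\<in>verts T. v \<in> B t) \<and> connected_in T {t \<in> verts T. v \<in> B t}"
    and cover: "\<forall>e\<in>edges G. \<exists>t\<in>verts T. e \<subseteq> B t"
    and sub: "\<And>t. t \<in> verts T \<Longrightarrow> B t \<subseteq> verts G"
    using td by (auto simp: tree_decomposition_def)
  \<comment> \<open>Were the top node of \<open>v\<close> strictly smaller, \<open>depth v\<close>
    would be smaller than \<open>depth u\<close> and stratification would give
    \<open>d v \<le> d u\<close>, contradicting the lexicographic comparison of the keys.\<close>
  have not_less: "\<not> tree_less T r (top_node T r B v) (top_node T r B u)"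
    if "u \<in> set vs" "v \<in> set vs" "key u \<le> key v" for u v
  proof
    assume less: "tree_less T r (top_node T r B v) (top_node T r B u)"
    have uv: "u \<in> verts G" "v \<in> verts G" using that vs by auto
    then have "top_node T r B u \<in> verts T" using pieces top_node(1)[OF tree, of u B] by auto
    then have "depth v < depth u" using tree_less_length[OF tree _ less] by (simp add: depth_def)
    moreover have "d v \<le> d u" using st uv less by (auto simp: stratified_def)
    ultimately show False using that(3) by (auto simp: key_def)
  qed
  define k where "k = Max ((\<lambda>t. card (B t)) ` verts T)"
  have k: "\<forall>t\<in>verts T. finite (B t) \<and> card (B t) \<le> k"
    using finT finV sub finite_subset by (fastforce simp: k_def)
  have degree_less: "degree (elim_graph G vs i) (vs ! (i - 1)) < k" if "i \<in> {1..length vs}" for i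
    using sorted_wrt_mono_rel[OF not_less sorted]
    by (intro degree_elim_graph_less_width[OF tree G vs(2,1) pieces cover _ k that])
  have "ordering_width G vs \<le> td_width T B"
  \<comment> \<open>Degrees below \<open>k\<close> match the \<open>-1\<close> in
    \<open>td_width\<close>. For the empty ordering the left side is \<open>-1\<close>, the least
    possible width.\<close>
  proof (cases "vs = []")
    case False
    then have "Max ((\<lambda>i. degree (elim_graph G vs i) (vs ! (i - 1))) ` {1..length vs}) < k"
      using degree_less by (subst Max_less_iff) (auto simp: Suc_le_eq)
    then show ?thesis using False by (simp add: ordering_width_def td_width_def k_def[symmetric])
  qed (simp add: ordering_width_def td_width_def)
  then show ?thesis using ord that by blast
qed

section \<open>From orderings to stratified tree decompositions\<close>

definition add_leaf :: "'t ugraph \<Rightarrow> 't \<Rightarrow> 't \<Rightarrow> 't ugraph" where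
  "add_leaf T x y = (insert y (verts T), insert {x, y} (edges T))"

lemma verts_add_leaf [simp]: "verts (add_leaf T x y) = insert y (verts T)"
  by (simp add: add_leaf_def)

context
  fixes T :: "'t ugraph" and x y :: 't
  assumes T: "finite_graph T" and x: "x \<in> verts T" and y: "y \<notin> verts T"
begin

lemma edge_add_leaf: "{a, y} \<in> edges (add_leaf T x y) \<Longrightarrow> a = x"
  using T x y by (auto simp: add_leaf_def finite_graph_def doubleton_eq_iff)

lemma is_path_add_leafI: "is_path T p \<Longrightarrow> is_path (add_leaf T x y) p"
  by (auto simp: is_path_def add_leaf_def intro: successively_mono)

lemma is_path_add_leafD:
  assumes "is_path (add_leaf T x y) p" "y \<notin> set p"
  shows "is_path T p"
proof -
  have "successively (\<lambda>a b. {a, b} \<in> edges T) p"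
    using assms(2) assms(1)[unfolded is_path_def]
    by (auto simp: add_leaf_def doubleton_eq_iff elim!: successively_mono)
  then show ?thesis using assms by (auto simp: is_path_def)
qed

lemma is_path_add_leaf_snoc: "is_path (add_leaf T x y) (p @ [y]) \<Longrightarrow> p \<noteq> [] \<Longrightarrow> last p = x"
  using is_path_append_iff[of p "[y]"] edge_add_leaf by auto

lemma is_path_add_leaf_Cons: "is_path (add_leaf T x y) (y # p) \<Longrightarrow> p \<noteq> [] \<Longrightarrow> hd p = x"
  using is_path_append_iff[of "[y]" p] edge_add_leaf[of "hd p"] by (auto simp: insert_commute)

text \<open>An inner occurrence of \<open>y\<close> would have its only neighbour \<open>x\<close>
  on both sides, against distinctness.\<close>

lemma is_path_add_leaf_end:
  assumes "is_path (add_leaf T x y) (p @ y # q)"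
  shows "p = [] \<or> q = []"
proof (rule ccontr)
  assume ne: "\<not> ?thesis"
  then have "is_path (add_leaf T x y) (p @ [y])" "is_path (add_leaf T x y) (y # q)"
    using assms is_path_append_iff[of "p @ [y]" q "add_leaf T x y"]
      is_path_append_iff[of p "y # q" "add_leaf T x y"] by simp_all
  then have "last p = x" "hd q = x"
    using ne is_path_add_leaf_snoc is_path_add_leaf_Cons by auto
  moreover have "distinct (p @ y # q)" using assms by (simp add: is_path_def)
  ultimately show False using ne by (metis IntI append_is_Nil_conv distinct_append empty_iff
        hd_in_set last_in_set list.set_intros(2))
qed

lemma finite_graph_add_leaf: "finite_graph (add_leaf T x y)"
  using T x y by (auto simp: finite_graph_def add_leaf_def card_2_iff)

text \<open>In a new cycle \<open>y\<close> sits at an end of the list. Its list neighbour and the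
  other end of the closing edge are then both \<open>x\<close>, yet they are the two ends of a
  distinct list of length at least two.\<close>

lemma acyclic_add_leaf:
  assumes "\<nexists>p. is_cycle T p"
  shows "\<nexists>p. is_cycle (add_leaf T x y) p"
proof
  assume "\<exists>p. is_cycle (add_leaf T x y) p"
  then obtain p where p: "is_path (add_leaf T x y) p" "3 \<le> length p"
      "{last p, hd p} \<in> edges (add_leaf T x y)"
    by (auto simp: is_cycle_def)
  show False
  proof (cases "y \<in> set p")
    case False
    have "hd p \<noteq> y" "last p \<noteq> y" using False p(2) by (cases p; auto)+
    then have "{last p, hd p} \<in> edges T"
      using p(3) by (auto simp: add_leaf_def doubleton_eq_iff)
    then have "is_cycle T p" using is_path_add_leafD[OF p(1) False] p by (simp add: is_cycle_def)
    then show False using assms by blast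
  next
    case True
    then obtain a b where ab: "p = a @ y # b" by (auto dest!: split_list)
    have two: "hd c \<noteq> last c" if "distinct c" "2 \<le> length c" for c :: "'t list"
      using that by (cases c) (auto split: if_splits)
    have "distinct a" "distinct b" using p(1) ab by (auto simp: is_path_def)
    have "a = [] \<or> b = []" using is_path_add_leaf_end p(1) ab by simp
    then show False
    proof
      assume "a = []"
      then have "b \<noteq> []" using ab p(2) by auto
      then have "hd b = x" using \<open>a = []\<close> ab p(1) is_path_add_leaf_Cons[of b] by simp
      moreover have "last b = x"
        using \<open>a = []\<close> \<open>b \<noteq> []\<close> ab p(3) edge_add_leaf by simp
      ultimately show False
        using two[OF \<open>distinct b\<close>] ab p(2) \<open>a = []\<close> by simp
    next
      assume "b = []"
      then have "a \<noteq> []" using ab p(2) by auto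
      then have "last a = x" using \<open>b = []\<close> ab p(1) is_path_add_leaf_snoc[of a] by simp
      moreover have "hd a = x"
        using \<open>b = []\<close> \<open>a \<noteq> []\<close> ab p(3) edge_add_leaf[of "hd a"] by (simp add: insert_commute)
      ultimately show False using two[OF \<open>distinct a\<close>] ab p(2) \<open>b = []\<close> by simp
    qed
  qed
qed

lemma connected_add_leaf: "connected_in T S \<Longrightarrow> connected_in (add_leaf T x y) S"
  unfolding connected_in_def using is_path_add_leafI by blast

lemma connected_add_leaf_insert:
  assumes S: "connected_in T S" "S \<subseteq> verts T" "x \<in> S"
  shows "connected_in (add_leaf T x y) (insert y S)"
proof -
  have to_y: "\<exists>p. is_path (add_leaf T x y) p \<and> hd p = a \<and> last p = y \<and> set p \<subseteq> insert y S"
    if "a \<in> S" for a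
  proof -
    obtain p where p: "is_path T p" "hd p = a" "last p = x" "set p \<subseteq> S"
      using S(1,3) \<open>a \<in> S\<close> unfolding connected_in_def by blast
    have "p \<noteq> []" using p(1) by (simp add: is_path_def)
    then have "is_path (add_leaf T x y) (p @ [y])"
      using p is_path_add_leafI[OF p(1)] S(2) y
      by (subst is_path_append_iff) (auto simp: add_leaf_def)
    then show ?thesis using p \<open>p \<noteq> []\<close> by (intro exI[of _ "p @ [y]"]) auto
  qed
  have from_y: "\<exists>p. is_path (add_leaf T x y) p \<and> hd p = y \<and> last p = a \<and> set p \<subseteq> insert y S"
    if "a \<in> S" for a
  proof -
    obtain p where "is_path (add_leaf T x y) p" "hd p = a" "last p = y" "set p \<subseteq> insert y S"
      using to_y[OF \<open>a \<in> S\<close>] by blast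
    then show ?thesis
      by (intro exI[of _ "rev p"]) (auto simp: is_path_rev hd_rev last_rev)
  qed
  have y_y: "\<exists>p. is_path (add_leaf T x y) p \<and> hd p = y \<and> last p = y \<and> set p \<subseteq> insert y S"
    by (intro exI[of _ "[y]"]) auto
  have "\<exists>p. is_path (add_leaf T x y) p \<and> hd p = a \<and> last p = b \<and> set p \<subseteq> insert y S"
    if "a \<in> S" "b \<in> S" for a b
    using connected_add_leaf[OF S(1)] that unfolding connected_in_def by blast
  then show ?thesis
    using to_y from_y y_y unfolding connected_in_def by blast
qed

lemma rooted_tree_add_leaf:
  assumes "rooted_tree T r"
  shows "rooted_tree (add_leaf T x y) r"
  using assms finite_graph_add_leaf acyclic_add_leaf connected_add_leaf_insert[of "verts T"] x
  by (auto simp: rooted_tree_def is_tree_def)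

text \<open>A path starting in the old tree can meet the leaf only as its last vertex.\<close>

lemma root_path_add_leaf_cases:
  assumes "is_path (add_leaf T x y) p" "hd p \<in> verts T"
  obtains "is_path T p" | q where "p = q @ [y]" "is_path T q" "hd q = hd p"
proof (cases "y \<in> set p")
  case False
  then show ?thesis using that(1) is_path_add_leafD assms by blast
next
  case True
  then obtain a b where ab: "p = a @ y # b" by (auto dest!: split_list)
  have "a \<noteq> []" using ab assms(2) y by auto
  then have "b = []" using is_path_add_leaf_end assms(1) ab by blast
  have "is_path (add_leaf T x y) a" "y \<notin> set a"
    using \<open>a \<noteq> []\<close> \<open>b = []\<close> ab assms(1) is_path_append_iff[of a "[y]"] by auto
  then show ?thesis
    using that(2)[of a] is_path_add_leafD \<open>a \<noteq> []\<close> \<open>b = []\<close> ab by simp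
qed

end

text \<open>
  Node \<open>t\<close> carries the piece that consists of \<open>v\<^sub>t\<close> and its neighbours in \<open>G\<^sub>t\<close>; the root \<open>0\<close>, with an
  empty piece, keeps the tree nonempty and connected. The neighbours of the eliminated vertex \<open>v\<close>
  form a clique in the smaller graph, hence are contained in the piece at the latest of them, and
  the node of \<open>v\<close> becomes a leaf there.
\<close>

definition elimination_tree ::
    "'a ugraph \<Rightarrow> 'a list \<Rightarrow> nat ugraph \<Rightarrow> (nat \<Rightarrow> 'a set) \<Rightarrow> bool" where
  "elimination_tree G vs T B \<longleftrightarrow> rooted_tree T 0 \<and> verts T = {0..length vs} \<and>
    (\<forall>p. is_path T p \<and> hd p = 0 \<longrightarrow> sorted_wrt (<) p) \<and> B 0 = {} \<and>
    (\<forall>t\<in>{1..length vs}. vs ! (t - 1) \<in> B t \<and> B t \<subseteq> set (take t vs) \<and>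
      card (B t) = Suc (degree (elim_graph G vs t) (vs ! (t - 1)))) \<and>
    (\<forall>i j. i < j \<and> j < length vs \<and> {vs ! i, vs ! j} \<in> edges G \<longrightarrow> vs ! i \<in> B (Suc j)) \<and>
    (\<forall>v\<in>verts G. connected_in T {t \<in> verts T. v \<in> B t})"

text \<open>Induction from the end of the list: a tree for \<open>eliminate v G\<close> and
  \<open>us\<close> keeps its nodes and pieces and gains one leaf for \<open>v\<close>.\<close>

lemma ex_elimination_tree:
  "finite_graph G \<Longrightarrow> distinct vs \<Longrightarrow> set vs = verts G \<Longrightarrow> \<exists>T B. elimination_tree G vs T B"
proof (induction vs arbitrary: G rule: rev_induct)
  case Nil
  let ?T = "({0}, {}) :: nat ugraph"
  have path: "is_path ?T p \<longleftrightarrow> p = [0]" for p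
  proof
    assume p: "is_path ?T p"
    then have "p \<noteq> []" "distinct p" "set p \<subseteq> {0}" by (auto simp: is_path_def)
    then show "p = [0]" by (cases p rule: list.exhaust; cases "tl p") auto
  qed simp
  then have "rooted_tree ?T 0"
    by (auto simp: rooted_tree_def is_tree_def finite_graph_def connected_in_def is_cycle_def)
  then show ?case
    unfolding elimination_tree_def using Nil path by (intro exI[of _ ?T] exI[of _ "\<lambda>_. {}"]) auto
next
  case (snoc v us)
  let ?n = "length us" and ?N = "neighbours G v" and ?H = "eliminate v G"
  have us: "distinct us" "v \<notin> set us" "set us = verts ?H" using snoc.prems by auto
  have N: "?N \<subseteq> set us" using neighbours_subset[OF snoc.prems(1), of v] us by auto
  obtain T B where "elimination_tree ?H us T B"
    using snoc.IH[OF finite_graph_eliminate[OF snoc.prems(1)] us(1,3)] by blast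
  then have tree: "rooted_tree T 0" and V: "verts T = {0..?n}"
    and sorted: "\<And>p. is_path T p \<Longrightarrow> hd p = 0 \<Longrightarrow> sorted_wrt (<) p" and B0: "B 0 = {}"
    and B: "\<And>t. t \<in> {1..?n} \<Longrightarrow> us ! (t - 1) \<in> B t \<and> B t \<subseteq> set (take t us) \<and>
      card (B t) = Suc (degree (elim_graph ?H us t) (us ! (t - 1)))"
    and edge: "\<And>i j. i < j \<Longrightarrow> j < ?n \<Longrightarrow> {us ! i, us ! j} \<in> edges ?H \<Longrightarrow> us ! i \<in> B (Suc j)"
    and conn: "\<And>u. u \<in> verts ?H \<Longrightarrow> connected_in T {t \<in> verts T. u \<in> B t}"
    unfolding elimination_tree_def by blast+
  have B_sub: "B t \<subseteq> set us" if "t \<le> ?n" for t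
    using B[of t] B0 that set_take_subset[of t us] by (cases "t = 0") auto
  obtain x where x: "x \<in> verts T" "?N \<subseteq> B x"
  proof (cases "?N = {}")
    case True
    then show ?thesis using that[of 0] V by simp
  next
    case False
    \<comment> \<open>The maximum of \<open>J\<close> is the list index of the latest neighbour of
      \<open>v\<close>; list index \<open>j\<close> belongs to node \<open>Suc j\<close>.\<close>
    define J where "J = {j. j < ?n \<and> us ! j \<in> ?N}"
    have "J \<noteq> {}" using False N by (force simp: J_def in_set_conv_nth)
    define j where "j = Max J"
    have "finite J" by (simp add: J_def)
    then have j: "j < ?n" "us ! j \<in> ?N" and max: "\<And>i. i \<in> J \<Longrightarrow> i \<le> j"
      using Max_in[of J] \<open>J \<noteq> {}\<close> by (auto simp: j_def J_def)
    have "u \<in> B (Suc j)" if u: "u \<in> ?N" for u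
    proof -
      obtain i where i: "i < ?n" "u = us ! i" using u N by (metis in_set_conv_nth subsetD)
      then have "i \<le> j" using max u by (simp add: J_def)
      show ?thesis
      proof (cases "i = j")
        case True
        then show ?thesis using B[of "Suc j"] i j by simp
      next
        case False
        \<comment> \<open>Eliminating \<open>v\<close> made these two neighbours adjacent, so the
          earlier one already lies in the piece of the later one.\<close>
        then have "us ! i \<noteq> us ! j" using i j us(1) by (simp add: nth_eq_iff_index_eq)
        then have "{us ! i, us ! j} \<in> edges ?H" using edges_eliminate_clique[of u G v] u i j by simp
        then show ?thesis using edge[of i j] False \<open>i \<le> j\<close> i j by simp
      qed
    qed
    then show ?thesis using that[of "Suc j"] V j by auto
  qed
  have T: "finite_graph T" using tree by (simp add: rooted_tree_def is_tree_def)
  have leaf: "Suc ?n \<notin> verts T" using V by simp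
  define T' where "T' = add_leaf T x (Suc ?n)"
  define B' where "B' = B(Suc ?n := insert v ?N)"
  have V': "verts T' = {0..length (us @ [v])}" using V by (auto simp: T'_def)
  have "rooted_tree T' 0"
    unfolding T'_def by (rule rooted_tree_add_leaf[OF T x(1) leaf tree])
  moreover have "sorted_wrt (<) p" if "is_path T' p" "hd p = 0" for p
  proof -
    have hd: "hd p \<in> verts T" using that(2) V by simp
    show ?thesis
    proof (cases rule: root_path_add_leaf_cases[OF T x(1) leaf that(1)[unfolded T'_def] hd])
      case 1
      then show ?thesis using sorted that(2) by blast
    next
      case (2 q)
      then have "sorted_wrt (<) q" "set q \<subseteq> {0..?n}"
        using sorted[of q] that(2) V by (auto simp: is_path_def)
      \<comment> \<open>The new node carries a larger number than all old ones, so root paths remain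
        increasing.\<close>
      then show ?thesis using 2(1) by (auto simp: sorted_wrt_append)
    qed
  qed
  moreover have "(us @ [v]) ! (t - 1) \<in> B' t \<and> B' t \<subseteq> set (take t (us @ [v])) \<and>
      card (B' t) = Suc (degree (elim_graph G (us @ [v]) t) ((us @ [v]) ! (t - 1)))"
    if t: "t \<in> {1..length (us @ [v])}" for t
  proof (cases "t = Suc ?n")
    case True
    have "v \<notin> ?N" using N us(2) by blast
    moreover have "finite ?N" using finite_subset[OF N] by blast
    ultimately show ?thesis
      using True N degree_eq_card_neighbours[OF snoc.prems(1), of v]
        elim_graph_length[of G "us @ [v]"] by (auto simp: B'_def)
  next
    case False
    then have t': "t \<in> {1..?n}" using t by auto
    then show ?thesis
      using B[OF t'] by (auto simp: B'_def nth_append elim_graph_snoc)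
  qed
  moreover have "(us @ [v]) ! i \<in> B' (Suc j)"
    if ij: "i < j" "j < length (us @ [v])" "{(us @ [v]) ! i, (us @ [v]) ! j} \<in> edges G" for i j
  proof (cases "j = ?n")
    case True
    then show ?thesis using ij by (auto simp: B'_def neighbours_def)
  next
    case False
    then have j: "j < ?n" using ij by simp
    then have "us ! i \<noteq> v" "us ! j \<noteq> v" using us(2) ij(1) by (metis less_trans nth_mem)+
    then have "{us ! i, us ! j} \<in> edges ?H"
      using ij j edges_eliminate_keep[of "{us ! i, us ! j}" G v] by (simp add: nth_append)
    then show ?thesis using edge ij j by (simp add: B'_def nth_append)
  qed
  moreover have "connected_in T' {t \<in> verts T'. u \<in> B' t}" if u: "u \<in> verts G" for u
  proof (cases "u = v")
    case True
    have "v \<notin> B t" if "t \<le> ?n" for t using B_sub[OF that] us(2) by auto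
    then have "{t \<in> verts T'. u \<in> B' t} = {Suc ?n}"
      using True unfolding V' by (auto simp: B'_def le_Suc_eq)
    moreover have "connected_in T' {Suc ?n}"
      unfolding connected_in_def using V' by (auto intro!: exI[of _ "[Suc ?n]"])
    ultimately show ?thesis by simp
  next
    case False
    define S where "S = {t \<in> verts T. u \<in> B t}"
    have S: "connected_in T S" "S \<subseteq> verts T" using conn u False by (auto simp: S_def)
    show ?thesis
    \<comment> \<open>A neighbour of \<open>v\<close> lies in the piece at \<open>x\<close>, so its
      node set grows by a leaf attached to it; for other old vertices the node set is
      unchanged.\<close>
    proof (cases "u \<in> ?N")
      case True
      have "{t \<in> verts T'. u \<in> B' t} = insert (Suc ?n) S"
        using True V by (auto simp: S_def T'_def B'_def)
      moreover have "x \<in> S" using x True by (auto simp: S_def)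
      ultimately show ?thesis
        using connected_add_leaf_insert[OF T x(1) leaf S] by (simp add: T'_def)
    next
      case False
      then have "{t \<in> verts T'. u \<in> B' t} = S"
        using \<open>u \<noteq> v\<close> V by (auto simp: S_def T'_def B'_def)
      then show ?thesis
        using connected_add_leaf[OF T x(1) leaf S(1)] by (simp add: T'_def)
    qed
  qed
  moreover have "B' 0 = {}" using B0 by (simp add: B'_def)
  ultimately show ?case
    unfolding elimination_tree_def using V' by (intro exI[of _ T'] exI[of _ B']) auto
qed

lemma tree_decomposition_of_ordering:
  fixes G :: "'a ugraph"
  assumes G: "finite_graph G" and ord: "elimination_ordering G d vs"
  obtains T :: "nat ugraph" and r B where "tree_decomposition G T r B" "stratified G d T r B"
    "td_width T B \<le> ordering_width G vs"
proof -
  have vs: "distinct vs" "set vs = verts G"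
    and d: "\<And>i j. i < j \<Longrightarrow> j < length vs \<Longrightarrow> d (vs ! i) \<le> d (vs ! j)"
    using ord by (auto simp: elimination_ordering_def)
  let ?n = "length vs"
  obtain T B where "elimination_tree G vs T B"
    using ex_elimination_tree[OF G vs] by blast
  then have tree: "rooted_tree T 0" and V: "verts T = {0..?n}"
    and sorted: "\<And>p. is_path T p \<Longrightarrow> hd p = 0 \<Longrightarrow> sorted_wrt (<) p" and B0: "B 0 = {}"
    and B: "\<And>t. t \<in> {1..?n} \<Longrightarrow> vs ! (t - 1) \<in> B t \<and> B t \<subseteq> set (take t vs) \<and>
      card (B t) = Suc (degree (elim_graph G vs t) (vs ! (t - 1)))"
    and edge: "\<And>i j. i < j \<Longrightarrow> j < ?n \<Longrightarrow> {vs ! i, vs ! j} \<in> edges G \<Longrightarrow> vs ! i \<in> B (Suc j)"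
    and conn: "\<And>u. u \<in> verts G \<Longrightarrow> connected_in T {t \<in> verts T. u \<in> B t}"
    unfolding elimination_tree_def by blast+
  have own: "vs ! i \<in> B (Suc i)" if "i < ?n" for i using B[of "Suc i"] that by simp
  \<comment> \<open>The piece at \<open>t\<close> holds only the first \<open>t\<close> vertices,
    and list indices start at \<open>0\<close>.\<close>
  have later: "i < t" if "i < ?n" "t \<in> verts T" "vs ! i \<in> B t" for i t
  proof -
    have "t \<in> {1..?n}" using that B0 V by (cases "t = 0") auto
    then have "vs ! i \<in> set (take t vs)" using B that by blast
    then obtain k where "k < t" "k < ?n" "vs ! k = vs ! i" by (auto simp: in_set_conv_nth)
    then show ?thesis using vs(1) that(1) by (simp add: nth_eq_iff_index_eq)
  qed
  have less: "s < t" if st: "tree_less T 0 s t" for s t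
  proof -
    obtain p where p: "is_path T p" "hd p = 0" "last p = t" "s \<in> set p" "s \<noteq> t"
      using st by (auto simp: tree_less_def)
    then obtain q where q: "p = q @ [t]"
      by (metis append_butlast_last_id empty_iff list.set(1))
    have "sorted_wrt (<) (q @ [t])" using sorted[OF p(1,2)] q by simp
    then show "s < t" using p(4,5) q by (auto simp: sorted_wrt_append)
  qed
  \<comment> \<open>The top node exceeds \<open>i\<close> by \<open>later\<close>, and it lies on
    the root path of \<open>Suc i\<close>, so by \<open>less\<close> it is at most
    \<open>Suc i\<close>.\<close>
  have top: "top_node T 0 B (vs ! i) = Suc i" if i: "i < ?n" for i
  proof -
    have "vs ! i \<in> verts G" "Suc i \<in> verts T" using i vs V by auto
    note t = top_node[OF tree conn[OF this(1)] this(2) own[OF i]]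
    have "i < top_node T 0 B (vs ! i)" using later[OF i t(1,2)] .
    moreover have "\<not> Suc i < top_node T 0 B (vs ! i)"
      using less[of "top_node T 0 B (vs ! i)" "Suc i"] t(3) \<open>Suc i \<in> verts T\<close>
      by (auto simp: tree_less_iff[OF tree])
    ultimately show ?thesis by simp
  qed
  have "tree_decomposition G T 0 B"
    unfolding tree_decomposition_def
  proof (intro conjI ballI tree conn)
    show "B t \<subseteq> verts G" if "t \<in> verts T" for t
      using that B[of t] B0 V set_take_subset[of t vs] vs(2) by (cases "t = 0") auto
    show "\<exists>t\<in>verts T. v \<in> B t" if "v \<in> verts G" for v
    proof -
      obtain i where "i < ?n" "v = vs ! i"
        using \<open>v \<in> verts G\<close> vs(2) by (metis in_set_conv_nth)
      then have "Suc i \<in> verts T" "v \<in> B (Suc i)" using own[of i] V by simp_all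
      then show ?thesis by blast
    qed
    show "\<exists>t\<in>verts T. e \<subseteq> B t" if e: "e \<in> edges G" for e
    proof -
      obtain a b where ab: "e = {a, b}" "a \<noteq> b" "a \<in> set vs" "b \<in> set vs"
        using e G vs(2) unfolding finite_graph_def card_2_iff by fastforce
      then obtain k l where kl: "k < ?n" "l < ?n" "a = vs ! k" "b = vs ! l" "k \<noteq> l"
        by (metis in_set_conv_nth)
      \<comment> \<open>With the ends sorted by list index, the piece of the later end contains
        both.\<close>
      then obtain i j where "i < j" "j < ?n" "e = {vs ! i, vs ! j}"
        using ab(1) by (metis insert_commute nat_neq_iff)
      then show ?thesis
        using own[of j] edge[of i j] e V bexI[of "\<lambda>t. e \<subseteq> B t" "Suc j" "verts T"] by simp
    qed
  qed
  moreover have "stratified G d T 0 B"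
    unfolding stratified_def
  proof (intro ballI impI)
    fix u v assume "u \<in> verts G" "v \<in> verts G"
      and uv: "tree_less T 0 (top_node T 0 B u) (top_node T 0 B v)"
    then obtain i j where ij: "i < ?n" "j < ?n" "u = vs ! i" "v = vs ! j"
      using vs(2) by (metis in_set_conv_nth)
    then have "i < j" using less[OF uv] top by simp
    then show "d u \<le> d v" using d ij by simp
  qed
  moreover have "td_width T B \<le> ordering_width G vs"
  proof (cases "vs = []")
    case True
    then show ?thesis using V B0 by (simp add: td_width_def ordering_width_def)
  next
    case False
    define m where "m = Max ((\<lambda>i. degree (elim_graph G vs i) (vs ! (i - 1))) ` {1..?n})"
    \<comment> \<open>A piece has one element more than the degree, which the \<open>-1\<close> in
      \<open>td_width\<close> cancels; the root has the empty piece.\<close>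
    have "card (B t) \<le> Suc m" if "t \<in> verts T" for t
    proof (cases "t = 0")
      case False
      then have "t \<in> {1..?n}" using that V by auto
      then show ?thesis using B[of t] by (auto simp: m_def intro!: Max_ge)
    qed (simp add: B0)
    then have "Max ((\<lambda>t. card (B t)) ` verts T) \<le> Suc m"
      using V by (subst Max_le_iff) auto
    then show ?thesis
      using False unfolding td_width_def ordering_width_def m_def[symmetric] by simp
  qed
  ultimately show ?thesis using that by blast
qed

section \<open>Equality of the two widths\<close>

text \<open>A nonempty set of integers has a least element only if bounded below; shifting by
  \<open>b\<close> reduces this to natural numbers. Mutual domination then suffices, so the
  translations need only inequalities between widths.\<close>

lemma Least_int_eqI:
  fixes P Q :: "int \<Rightarrow> bool"
  assumes "P a" and bound: "\<And>w. P w \<Longrightarrow> b \<le> w"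
    and PQ: "\<And>w. P w \<Longrightarrow> \<exists>w'\<le>w. Q w'" and QP: "\<And>w. Q w \<Longrightarrow> \<exists>w'\<le>w. P w'"
  shows "Least P = Least Q"
proof -
  obtain m where m: "P m" "\<And>w. P w \<Longrightarrow> nat (m - b) \<le> nat (w - b)"
    using ex_has_least_nat[of P a "\<lambda>w. nat (w - b)"] \<open>P a\<close> by blast
  have min: "m \<le> w" if "P w" for w
    using m(2)[OF that] bound[OF that] bound[OF m(1)] by linarith
  have minQ: "m \<le> w" if "Q w" for w using QP[OF that] min by force
  have "Q m" using PQ[OF m(1)] minQ by (metis order_antisym)
  then have "Least Q = m" using minQ by (intro Least_equality)
  moreover have "Least P = m" using m(1) min by (intro Least_equality)
  ultimately show ?thesis by simp
qed

theorem theorem3p1: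
  fixes G :: "'a ugraph" and d :: "'a \<Rightarrow> nat"
  assumes "finite_graph G"
  shows "tw G d = ew G d"
proof -
  \<comment> \<open>Sorting the vertices by \<open>d\<close> gives some elimination ordering, so a
    minimum is taken over a nonempty set.\<close>
  obtain xs where xs: "set xs = verts G" "distinct xs"
    using finite_distinct_list[of "verts G"] assms by (auto simp: finite_graph_def)
  have "sorted (map d (sort_key d xs))" by simp
  then have ord: "elimination_ordering G d (sort_key d xs)"
    using xs by (auto simp: elimination_ordering_def sorted_map sorted_wrt_iff_nth_less
        simp del: sorted_sort_key)
  have "ew G d = tw G d"
    unfolding ew_def tw_def
  \<comment> \<open>Orderings play the role of \<open>P\<close>, since the lower bound
    \<open>-1\<close> is immediate from \<open>ordering_width\<close>.\<close>
  proof (intro Least_int_eqI[where a = "ordering_width G (sort_key d xs)" and b = "-1"])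
    show "\<exists>vs. elimination_ordering G d vs \<and>
        ordering_width G vs = ordering_width G (sort_key d xs)"
      using ord by blast
    show "\<exists>w'\<le>w. \<exists>(T :: nat ugraph) r B.
        tree_decomposition G T r B \<and> stratified G d T r B \<and> td_width T B = w'"
      if "\<exists>vs. elimination_ordering G d vs \<and> ordering_width G vs = w" for w
      using that tree_decomposition_of_ordering[OF assms] by metis
    show "\<exists>w'\<le>w. \<exists>vs. elimination_ordering G d vs \<and> ordering_width G vs = w'"
      if "\<exists>(T :: nat ugraph) r B.
        tree_decomposition G T r B \<and> stratified G d T r B \<and> td_width T B = w" for w
      using that ordering_of_tree_decomposition[OF assms] by metis
  qed (auto simp: ordering_width_def)
  then show ?thesis by simp
qed

end
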